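(* Let $\mu,\delta>0$ and $L_{\mathrm d}=\frac{\|G\|^2}{\mu}$. For each $y\in\mathbb{R}^m$ let $u_\mu(y)\in U$ satisfy $0\le\mathcal{L}_\mu(u_\mu(y),y)-d_{U,\mu}(y)\le\delta$. Then for all $x,y\in\mathbb{R}^m$ $$0\le\mathcal{L}_\mu(u_\mu(y),y)+\langle\nabla_x\mathcal{L}_\mu(u_\mu(y),y),x-y\rangle-d_{U,\mu}(x)\le\frac{2L_{\mathrm d}}2\|x-y\|^2+3\delta ,$$ i.e. the smoothed dual function $d_{U,\mu}$ is equipped with a first order inexact $(3\delta,2L_{\mathrm d})$-oracle.
   Context: Setting. $f:\mathbb{R}^n\to\mathbb{R}\cup\{+\infty\}$ is proper, closed and convex, $U\subseteq\mathrm{dom} f$ is nonempty, closed, convex and bounded, $G\in\mathbb{R}^{m\times n}$, $g\in\mathbb{R}^m$; these are the data of the problem $f^*=\min_{u\in U}f(u)$ s.t. $Gu+g\in\mathcal{K}$ with $\mathcal{K}\subseteq\mathbb{R}^m$ a nonempty closed convex cone, for which a Lagrange multiplier closing the duality gap is assumed to exist. Norms are Euclidean, $\|G\|$ is the spectral norm. $p_U$ is a prox-function: continuous and strongly convex on $U$ with strong convexity parameter $1$ and $\min_{u\in U}p_U(u)=0$. The smoothed Lagrangian and dual function are $\mathcal{L}_\mu(u,x)=f(u)+\langle x,Gu+g\rangle+\mu\,p_U(u)$ and $d_{U,\mu}(x)=\min_{u\in U}\mathcal{L}_\mu(u,x)$; $\nabla_x\mathcal{L}_\mu(u,x)=Gu+g$.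 *)

theory Defs
  imports "HOL-Analysis.Analysis"
begin

(* Extended-real-valued convex functions take values in ereal; properness excludes the value
   -\<infinity>.  Closedness and convexity are those of the epigraph, a subset of 'a \<times> real. *)

definition effective_domain :: "('a \<Rightarrow> ereal) \<Rightarrow> 'a set" where
  "effective_domain f = {x. f x < \<infinity>}"

definition proper_fun :: "('a \<Rightarrow> ereal) \<Rightarrow> bool" where
  "proper_fun f \<longleftrightarrow> (\<forall>x. f x \<noteq> -\<infinity>) \<and> effective_domain f \<noteq> {}"

definition ereal_epigraph :: "('a \<Rightarrow> ereal) \<Rightarrow> ('a \<times> real) set" where
  "ereal_epigraph f = {(x, t). f x \<le> ereal t}"

definition closed_fun :: "('a::topological_space \<Rightarrow> ereal) \<Rightarrow> bool" where
  "closed_fun f \<longleftrightarrow> closed (ereal_epigraph f)"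

definition convex_fun :: "('a::real_vector \<Rightarrow> ereal) \<Rightarrow> bool" where
  "convex_fun f \<longleftrightarrow> convex (ereal_epigraph f)"

definition strongly_convex_on :: "real \<Rightarrow> 'a::real_normed_vector set \<Rightarrow> ('a \<Rightarrow> real) \<Rightarrow> bool" where
  "strongly_convex_on \<sigma> S p \<longleftrightarrow> convex S \<and>
    (\<forall>u\<in>S. \<forall>v\<in>S. \<forall>t\<in>{0..1}.
       p (t *\<^sub>R u + (1 - t) *\<^sub>R v)
         \<le> t * p u + (1 - t) * p v - \<sigma> / 2 * t * (1 - t) * (norm (u - v))\<^sup>2)"

definition is_min_value :: "('a \<Rightarrow> 'b::order) \<Rightarrow> 'a set \<Rightarrow> 'b \<Rightarrow> bool" where
  "is_min_value h S v \<longleftrightarrow> v \<in> h ` S \<and> (\<forall>u\<in>S. v \<le> h u)"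

(* The minimum over a possibly infinite set; meaningful only when it is attained. *)
definition min_value :: "('a \<Rightarrow> 'b::order) \<Rightarrow> 'a set \<Rightarrow> 'b" where
  "min_value h S = (THE v. is_min_value h S v)"

lemma min_value_eqI: "is_min_value h S v \<Longrightarrow> min_value h S = v"
  unfolding min_value_def by (rule the_equality) (auto simp: is_min_value_def intro: order_antisym)

definition prox_function :: "'a::real_normed_vector set \<Rightarrow> ('a \<Rightarrow> real) \<Rightarrow> bool" where
  "prox_function U p \<longleftrightarrow>
    continuous_on U p \<and> strongly_convex_on 1 U p \<and> is_min_value p U 0"

definition smoothed_lagrangian ::
  "(real^'n \<Rightarrow> ereal) \<Rightarrow> real^'n^'m \<Rightarrow> real^'m \<Rightarrow> (real^'n \<Rightarrow> real) \<Rightarrow> real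
     \<Rightarrow> real^'n \<Rightarrow> real^'m \<Rightarrow> ereal" where
  "smoothed_lagrangian f G g p \<mu> u x = f u + ereal (x \<bullet> (G *v u + g)) + ereal (\<mu> * p u)"

definition lagrangian_grad :: "real^'n^'m \<Rightarrow> real^'m \<Rightarrow> real^'n \<Rightarrow> real^'m" where
  "lagrangian_grad G g u = G *v u + g"

lemma gderiv_smoothed_lagrangian:
  assumes "\<bar>f u\<bar> \<noteq> \<infinity>"
  shows "GDERIV (\<lambda>x. real_of_ereal (smoothed_lagrangian f G g p \<mu> u x)) x :> lagrangian_grad G g u"
proof -
  obtain r where "f u = ereal r"
    using assms by (cases "f u") auto
  then show ?thesis
    unfolding gderiv_def smoothed_lagrangian_def lagrangian_grad_def
    by (auto intro!: derivative_eq_intros)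
qed

definition smoothed_dual ::
  "(real^'n \<Rightarrow> ereal) \<Rightarrow> real^'n^'m \<Rightarrow> real^'m \<Rightarrow> (real^'n \<Rightarrow> real) \<Rightarrow> (real^'n) set \<Rightarrow> real
     \<Rightarrow> real^'m \<Rightarrow> ereal" where
  "smoothed_dual f G g p U \<mu> x = min_value (\<lambda>u. smoothed_lagrangian f G g p \<mu> u x) U"

definition polar_cone :: "'a::real_inner set \<Rightarrow> 'a set" where
  "polar_cone K = {x. \<forall>w\<in>K. x \<bullet> w \<le> 0}"

(* x is a multiplier for the problem of minimising f u over u \<in> U with G u + g \<in> K, whose optimal
   value is fstar: with the sign convention f u + x \<bullet> (G u + g) of the Lagrangian, dual feasibility
   means membership in the polar cone of K, and the dual value at x equals fstar. *)
definition lagrange_multiplier ::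
  "(real^'n \<Rightarrow> ereal) \<Rightarrow> (real^'n) set \<Rightarrow> real^'n^'m \<Rightarrow> real^'m \<Rightarrow> (real^'m) set \<Rightarrow> ereal
     \<Rightarrow> real^'m \<Rightarrow> bool" where
  "lagrange_multiplier f U G g K fstar x \<longleftrightarrow>
    x \<in> polar_cone K \<and> is_min_value (\<lambda>u. f u + ereal (x \<bullet> (G *v u + g))) U fstar"

(* First order inexact (\<delta>, L)-oracle of a concave function d: at each y the oracle returns the
   approximate value dval y and the approximate gradient dgrad y. *)
definition inexact_oracle ::
  "real \<Rightarrow> real \<Rightarrow> ('a::real_inner \<Rightarrow> ereal) \<Rightarrow> ('a \<Rightarrow> ereal) \<Rightarrow> ('a \<Rightarrow> 'a) \<Rightarrow> bool" where
  "inexact_oracle \<delta> L d dval dgrad \<longleftrightarrow>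
    (\<forall>x y. 0 \<le> dval y + ereal (dgrad y \<bullet> (x - y)) - d x \<and>
           dval y + ereal (dgrad y \<bullet> (x - y)) - d x \<le> ereal (L / 2 * (norm (x - y))\<^sup>2 + \<delta>))"

end

theory Submission
  imports Defs
begin

text \<open>
  A lower semicontinuous function attains its minimum on the compact set \<open>U\<close>, and a \<open>\<mu>\<close>-strongly
  convex function exceeds its minimum by at least \<open>\<mu> / 2\<close> times the squared distance to the
  minimiser. Let \<open>v\<close> and \<open>w\<close> be the exact minimisers of the smoothed Lagrangian at \<open>x\<close> and \<open>y\<close>, and
  let \<open>u\<close> be the approximate one at \<open>y\<close>. The Lagrangian is affine in the multiplier, so the oracle
  gap is \<open>L(u, y) - L(v, y) + \<langle>G (u - v), x - y\<rangle>\<close>. Splitting \<open>u - v = (u - w) + (w - v)\<close>, quadratic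
  growth at \<open>w\<close> together with Young's inequality bounds the gap by \<open>L\<^sub>d \<parallel>x - y\<parallel>\<^sup>2 + 2 \<delta>\<close>.
\<close>

text \<open>Finite intersection property: finitely many sets \<open>S v\<close> share the best of
  the points \<open>v\<close> that index them, so by compactness all of them share a point, which is
  a minimiser.\<close>

lemma closed_fun_attains_min:
  fixes f :: "'a::t2_space \<Rightarrow> ereal"
  assumes "closed_fun f" "proper_fun f" "U \<subseteq> effective_domain f" "compact U" "U \<noteq> {}"
    and q: "continuous_on U q"
  obtains u where "u \<in> U" "\<And>v. v \<in> U \<Longrightarrow> f u + ereal (q u) \<le> f v + ereal (q v)"
proof -
  define S where "S v = {u \<in> U. f u + ereal (q u) \<le> f v + ereal (q v)}" for v
  have fin: "\<exists>r. f u = ereal r" if "u \<in> U" for u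
    using that assms by (cases "f u") (auto simp: proper_fun_def effective_domain_def)
  have cl: "closed (S v)" if v: "v \<in> U" for v
  proof -
    obtain r where r: "f v = ereal r" using fin[OF v] by blast
    \<comment> \<open>Moving the finite term \<open>q u\<close> to the right turns
      \<open>S v\<close> into the preimage of the closed epigraph under a continuous map.\<close>
    have "f u + ereal (q u) \<le> f v + ereal (q v) \<longleftrightarrow> (u, r + q v - q u) \<in> ereal_epigraph f"
      if "u \<in> U" for u
      using fin[OF that] r by (auto simp: ereal_epigraph_def)
    then have eq: "S v = U \<inter> (\<lambda>u. (u, r + q v - q u)) -` ereal_epigraph f"
      by (auto simp: S_def)
    have "continuous_on U (\<lambda>u. (u, r + q v - q u))"
      by (intro continuous_intros q)
    then show ?thesis
      unfolding eq using assms compact_imp_closed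
      by (intro continuous_closed_preimage) (auto simp: closed_fun_def)
  qed
  have "U \<inter> \<Inter>(S ` U) \<noteq> {}"
  proof (rule compact_imp_fip_image[OF \<open>compact U\<close>])
    show "closed (S v)" if "v \<in> U" for v using cl[OF that] .
    fix V assume V: "finite V" "V \<subseteq> U"
    show "U \<inter> \<Inter>(S ` V) \<noteq> {}"
    proof (cases "V = {}")
      case False
      let ?\<phi> = "\<lambda>v. f v + ereal (q v)"
      have "Min (?\<phi> ` V) \<in> ?\<phi> ` V" using V False by (intro Min_in) auto
      then obtain u where "u \<in> V" "Min (?\<phi> ` V) = ?\<phi> u" by blast
      moreover have "Min (?\<phi> ` V) \<le> ?\<phi> v" if "v \<in> V" for v
        using V that by (intro Min_le) auto
      ultimately have "u \<in> V" "\<And>v. v \<in> V \<Longrightarrow> ?\<phi> u \<le> ?\<phi> v" by auto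
      then have "u \<in> U \<inter> \<Inter>(S ` V)" using V by (auto simp: S_def)
      then show ?thesis by blast
    qed (use \<open>U \<noteq> {}\<close> in auto)
  qed
  then obtain u where "u \<in> U" "\<And>v. v \<in> U \<Longrightarrow> u \<in> S v" by auto
  then show ?thesis using that by (auto simp: S_def)
qed

lemma convex_fun_real:
  assumes "convex_fun f" "convex U" and F: "\<And>u. u \<in> U \<Longrightarrow> f u = ereal (F u)"
  shows "convex_on U F"
proof (rule convex_onI[OF _ \<open>convex U\<close>])
  fix t u v assume t: "0 < t" "t < (1::real)" and uv: "u \<in> U" "v \<in> U"
  have "(u, F u) \<in> ereal_epigraph f" "(v, F v) \<in> ereal_epigraph f"
    using uv F by (auto simp: ereal_epigraph_def)
  then have "(1 - t) *\<^sub>R (u, F u) + t *\<^sub>R (v, F v) \<in> ereal_epigraph f"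
    using assms t unfolding convex_fun_def by (intro convexD) auto
  moreover have "(1 - t) *\<^sub>R u + t *\<^sub>R v \<in> U"
    using assms t uv by (intro convexD) auto
  ultimately show "F ((1 - t) *\<^sub>R u + t *\<^sub>R v) \<le> (1 - t) * F u + t * F v"
    using F by (auto simp: ereal_epigraph_def)
qed

lemma strongly_convex_on_add_convex:
  assumes "convex_on S F" "strongly_convex_on \<sigma> S p" "0 \<le> \<mu>"
  shows "strongly_convex_on (\<mu> * \<sigma>) S (\<lambda>u. F u + \<mu> * p u)"
  unfolding strongly_convex_on_def
proof (intro conjI ballI)
  show "convex S" using assms by (simp add: strongly_convex_on_def)
  fix u v t assume uv: "u \<in> S" "v \<in> S" and t: "t \<in> {0..1::real}"
  have 1: "F (t *\<^sub>R u + (1 - t) *\<^sub>R v) \<le> t * F u + (1 - t) * F v"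
    using convex_onD[OF assms(1), of "1 - t" u v] uv t by simp
  have "p (t *\<^sub>R u + (1 - t) *\<^sub>R v)
      \<le> t * p u + (1 - t) * p v - \<sigma> / 2 * t * (1 - t) * (norm (u - v))\<^sup>2"
    using assms uv t by (simp add: strongly_convex_on_def)
  from add_mono[OF 1 mult_left_mono[OF this \<open>0 \<le> \<mu>\<close>]]
  show "F (t *\<^sub>R u + (1 - t) *\<^sub>R v) + \<mu> * p (t *\<^sub>R u + (1 - t) *\<^sub>R v)
      \<le> t * (F u + \<mu> * p u) + (1 - t) * (F v + \<mu> * p v)
        - \<mu> * \<sigma> / 2 * t * (1 - t) * (norm (u - v))\<^sup>2"
    by (simp add: algebra_simps)
qed

text \<open>Minimality of \<open>w\<close> is tested at a point of the segment from \<open>u\<close>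
  to \<open>w\<close>; dividing by the weight \<open>1 - z\<close> of \<open>u\<close> and letting
  \<open>z\<close> tend to 1 gives the full constant.\<close>

lemma strongly_convex_on_quadratic_growth:
  assumes sc: "strongly_convex_on \<sigma> S h" and w: "w \<in> S" "\<And>u. u \<in> S \<Longrightarrow> h w \<le> h u"
    and u: "u \<in> S"
  shows "\<sigma> / 2 * (norm (u - w))\<^sup>2 \<le> h u - h w"
proof (rule field_le_mult_one_interval)
  fix z :: real assume z: "0 < z" "z < 1"
  have "(1 - z) *\<^sub>R u + z *\<^sub>R w \<in> S"
    using sc u w z unfolding strongly_convex_on_def by (intro convexD) auto
  then have "h w \<le> h ((1 - z) *\<^sub>R u + (1 - (1 - z)) *\<^sub>R w)" using w by simp
  also have "\<dots> \<le> (1 - z) * h u + (1 - (1 - z)) * h w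
      - \<sigma> / 2 * (1 - z) * (1 - (1 - z)) * (norm (u - w))\<^sup>2"
    using u w z by (intro sc[unfolded strongly_convex_on_def, THEN conjunct2, rule_format]) auto
  finally have "(1 - z) * (z * (\<sigma> / 2 * (norm (u - w))\<^sup>2)) \<le> (1 - z) * (h u - h w)"
    by (simp add: algebra_simps)
  then show "z * (\<sigma> / 2 * (norm (u - w))\<^sup>2) \<le> h u - h w"
    using z by simp
qed

lemma young_inequality_weighted:
  fixes a b c \<mu> :: real
  assumes "0 < \<mu>"
  shows "c * a * b \<le> c\<^sup>2 / \<mu> / 2 * b\<^sup>2 + \<mu> / 2 * a\<^sup>2"
proof -
  have "0 \<le> (c * b - \<mu> * a)\<^sup>2 / (2 * \<mu>)" using assms by simp
  also have "\<dots> = c\<^sup>2 / \<mu> / 2 * b\<^sup>2 + \<mu> / 2 * a\<^sup>2 - c * a * b"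
    using assms by (simp add: field_simps power2_eq_square)
  finally show ?thesis by simp
qed

text \<open>The weights in Young's inequality are chosen so that the term in \<open>a\<close> is
  exactly what quadratic growth with parameter \<mu> controls; the coefficient of the term in
  \<open>b\<close> is then half of \<open>L\<^sub>d\<close>.\<close>

lemma inner_matrix_vector_le:
  fixes G :: "real^'n^'m"
  assumes "0 < \<mu>"
  shows "(G *v a) \<bullet> b
    \<le> (onorm (\<lambda>v. G *v v))\<^sup>2 / \<mu> / 2 * (norm b)\<^sup>2 + \<mu> / 2 * (norm a)\<^sup>2"
proof -
  have "(G *v a) \<bullet> b \<le> norm (G *v a) * norm b"
    by (rule norm_cauchy_schwarz)
  also have "\<dots> \<le> onorm (\<lambda>v. G *v v) * norm a * norm b"
    by (intro mult_right_mono onorm matrix_vector_mul_bounded_linear) simp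
  also note young_inequality_weighted[OF assms]
  finally show ?thesis .
qed

theorem theorem3p10:
  fixes f :: "real^'n \<Rightarrow> ereal" and U :: "(real^'n) set"
    and G :: "real^'n^'m" and g :: "real^'m" and K :: "(real^'m) set" and fstar :: ereal
    and p :: "real^'n \<Rightarrow> real" and \<mu> \<delta> L\<^sub>d :: real and u\<^sub>\<mu> :: "real^'m \<Rightarrow> real^'n"
  assumes "proper_fun f" and "closed_fun f" and "convex_fun f"
    and "U \<subseteq> effective_domain f" and "U \<noteq> {}" and "closed U" and "convex U" and "bounded U"
    and "convex_cone K" and "closed K"
    and "is_min_value f {u \<in> U. G *v u + g \<in> K} fstar"
    and "\<exists>x. lagrange_multiplier f U G g K fstar x"
    and "prox_function U p"
    and "\<mu> > 0" and "\<delta> > 0"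
    and "L\<^sub>d = (onorm (\<lambda>v. G *v v))\<^sup>2 / \<mu>"
    and "\<And>y. u\<^sub>\<mu> y \<in> U"
    and "\<And>y. 0 \<le> smoothed_lagrangian f G g p \<mu> (u\<^sub>\<mu> y) y - smoothed_dual f G g p U \<mu> y"
    and "\<And>y. smoothed_lagrangian f G g p \<mu> (u\<^sub>\<mu> y) y - smoothed_dual f G g p U \<mu> y \<le> ereal \<delta>"
  shows "(\<forall>x y.
      0 \<le> smoothed_lagrangian f G g p \<mu> (u\<^sub>\<mu> y) y
            + ereal (lagrangian_grad G g (u\<^sub>\<mu> y) \<bullet> (x - y)) - smoothed_dual f G g p U \<mu> x \<and>
      smoothed_lagrangian f G g p \<mu> (u\<^sub>\<mu> y) y
            + ereal (lagrangian_grad G g (u\<^sub>\<mu> y) \<bullet> (x - y)) - smoothed_dual f G g p U \<mu> x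
        \<le> ereal (2 * L\<^sub>d / 2 * (norm (x - y))\<^sup>2 + 3 * \<delta>))
    \<and> inexact_oracle (3 * \<delta>) (2 * L\<^sub>d) (smoothed_dual f G g p U \<mu>)
        (\<lambda>y. smoothed_lagrangian f G g p \<mu> (u\<^sub>\<mu> y) y) (\<lambda>y. lagrangian_grad G g (u\<^sub>\<mu> y))"
proof -
  note prox = \<open>prox_function U p\<close>[unfolded prox_function_def]
  \<comment> \<open>On \<open>U\<close> properness rules out minus infinity and the effective domain
    rules out plus infinity, so the argument can be carried out in the reals.\<close>
  define F where "F u = real_of_ereal (f u)" for u
  have F: "f u = ereal (F u)" if "u \<in> U" for u
    using that assms(1,4) by (cases "f u") (auto simp: F_def proper_fun_def effective_domain_def)
  define h where "h x u = F u + x \<bullet> (G *v u + g) + \<mu> * p u" for x u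
  have L: "smoothed_lagrangian f G g p \<mu> u x = ereal (h x u)" if "u \<in> U" for u x
    using F[OF that] by (simp add: smoothed_lagrangian_def h_def)
  have "convex_on U F"
    using convex_fun_real[OF \<open>convex_fun f\<close> \<open>convex U\<close> F] .
  have sc: "strongly_convex_on \<mu> U (h x)" for x
  proof -
    have "convex_on U (\<lambda>u. x \<bullet> (G *v u + g))"
      by (rule convex_onI[OF _ \<open>convex U\<close>])
        (simp add: matrix_vector_right_distrib matrix_vector_mult_scaleR inner_add_right algebra_simps)
    then have "convex_on U (\<lambda>u. F u + x \<bullet> (G *v u + g))"
      using \<open>convex_on U F\<close> by (intro convex_on_add)
    from strongly_convex_on_add_convex[OF this, of 1 p \<mu>] prox \<open>\<mu> > 0\<close>
    show ?thesis by (simp add: h_def[abs_def])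
  qed
  have "\<exists>u\<in>U. \<forall>v\<in>U. h x u \<le> h x v" for x
  proof -
    have "compact U" using assms by (simp add: compact_eq_bounded_closed)
    moreover have "continuous_on U (\<lambda>u. x \<bullet> (G *v u + g) + \<mu> * p u)"
      using prox by (intro continuous_intros matrix_vector_mult_linear_continuous_on) auto
    ultimately obtain u where u: "u \<in> U" and min: "\<And>v. v \<in> U \<Longrightarrow>
        f u + ereal (x \<bullet> (G *v u + g) + \<mu> * p u) \<le> f v + ereal (x \<bullet> (G *v v + g) + \<mu> * p v)"
      using closed_fun_attains_min[OF assms(2,1,4) _ assms(5)] by blast
    have "h x u \<le> h x v" if "v \<in> U" for v
      using min[OF that] F[OF u] F[OF that] by (simp add: h_def)
    with u show ?thesis by blast
  qed
  then obtain m where m: "\<And>x. m x \<in> U" "\<And>x v. v \<in> U \<Longrightarrow> h x (m x) \<le> h x v" by metis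
  \<comment> \<open>Attainment at \<open>m x\<close> is what gives the definite description in
    \<open>min_value\<close> its meaning.\<close>
  have D: "smoothed_dual f G g p U \<mu> x = ereal (h x (m x))" for x
    unfolding smoothed_dual_def
    by (rule min_value_eqI) (use m L in \<open>auto simp: is_min_value_def image_iff intro!: bexI[of _ "m x"]\<close>)
  have growth: "\<mu> / 2 * (norm (u - m x))\<^sup>2 \<le> h x u - h x (m x)" if "u \<in> U" for u x
    using strongly_convex_on_quadratic_growth[OF sc m] that by blast
  have bound: "0 \<le> smoothed_lagrangian f G g p \<mu> (u\<^sub>\<mu> y) y
        + ereal (lagrangian_grad G g (u\<^sub>\<mu> y) \<bullet> (x - y)) - smoothed_dual f G g p U \<mu> x \<and>
      smoothed_lagrangian f G g p \<mu> (u\<^sub>\<mu> y) y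
        + ereal (lagrangian_grad G g (u\<^sub>\<mu> y) \<bullet> (x - y)) - smoothed_dual f G g p U \<mu> x
      \<le> ereal (2 * L\<^sub>d / 2 * (norm (x - y))\<^sup>2 + 3 * \<delta>)" for x y
  proof -
    let ?u = "u\<^sub>\<mu> y" and ?v = "m x" and ?w = "m y"
    \<comment> \<open>Linearising at \<open>y\<close> is exact, so the oracle's model at
      \<open>x\<close> is the value \<open>h x ?u\<close>.\<close>
    have affine: "h y u + (G *v u + g) \<bullet> (x - y) = h x u" for u
      by (simp add: h_def inner_diff_left inner_commute[of "G *v u + g"])
    have "h y ?u - h y ?w \<le> \<delta>"
      using assms(19)[of y] L[OF assms(17)] D by simp
    then have uw: "\<mu> / 2 * (norm (?u - ?w))\<^sup>2 \<le> \<delta>"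
      using growth[OF assms(17)[of y], of y] by simp
    have vw: "\<mu> / 2 * (norm (?w - ?v))\<^sup>2 \<le> h y ?v - h y ?w"
      using growth[OF m(1)[of x], of y] by (simp add: norm_minus_commute)
    have "h x ?u - h x ?v = (h y ?u - h y ?v) + (G *v (?u - ?w)) \<bullet> (x - y)
        + (G *v (?w - ?v)) \<bullet> (x - y)"
      using affine[of ?u] affine[of ?v]
      by (simp add: matrix_vector_mult_diff_distrib inner_diff_left inner_add_left)
    \<comment> \<open>Each inner product costs half of \<open>L\<^sub>d\<close> times the squared
      distance. The first also costs \<delta> by \<open>uw\<close>; the second costs
      \<open>h y ?v - h y ?w\<close> by \<open>vw\<close>, which turns
      \<open>h y ?u - h y ?v\<close> into \<open>h y ?u - h y ?w\<close>, the other
      \<delta>.\<close>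
    also have "\<dots> \<le> L\<^sub>d * (norm (x - y))\<^sup>2 + 2 * \<delta>"
      using inner_matrix_vector_le[OF \<open>\<mu> > 0\<close>, of G "?u - ?w" "x - y"]
        inner_matrix_vector_le[OF \<open>\<mu> > 0\<close>, of G "?w - ?v" "x - y"] uw vw \<open>h y ?u - h y ?w \<le> \<delta>\<close>
      unfolding assms(16) by simp
    \<comment> \<open>The lower bound is minimality of \<open>m x\<close>; the upper bound relaxes
      \<open>2 * \<delta>\<close> to \<open>3 * \<delta>\<close>.\<close>
    finally show ?thesis
      using affine[of ?u] m(2)[OF assms(17)] \<open>\<delta> > 0\<close>
      by (simp add: L[OF assms(17)] D lagrangian_grad_def)
  qed
  then show ?thesis by (simp add: inexact_oracle_def)
qed

end
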